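(* Consider a switching system $x(t+1)=f_{\sigma(t)}(x(t))$ on $\mathbb{R}^n$ with modes $[M]=\{1,\dots,M\}$, and a Path-Complete Lyapunov function for this system with graph $\mathbf{G}=(S,E)$ and pieces $(V_s)_{s\in S}$. Let $O^\star(\mathbf{G})=(S_O^\star,E_O^\star)$ be the unique strongly connected, deterministic and complete sub-graph of the observer graph $O(\mathbf{G})$. Then the function $$V(x)=\min_{Q\in S_O^\star}\Big(\max_{s\in Q}V_s(x)\Big)$$ is a common Lyapunov function for the system.
   Context: System: $M\ge 1$, each $f_i:\mathbb{R}^n\to\mathbb{R}^n$ ($i\in[M]$) is continuous with $f_i(x)=0\Leftrightarrow x=0$; the switching sequence $\sigma(\cdot)$ takes arbitrary values in $[M]$. Graphs: a graph $\mathbf{G}=(S,E)$ is a directed labeled graph with finite nonempty node set $S$ and edge set $E\subseteq S\times S\times[M]$; an edge $(p,q,\sigma)$ goes from $p$ to $q$ with label $\sigma$. The label of a path is the concatenation of the labels of its edges. $\mathbf{G}$ is path-complete if for any finite sequence $w$ over $[M]$ there is a path in $\mathbf{G}$ whose label contains $w$ as a contiguous subsequence. $\mathbf{G}$ is complete if for every $s\in S$ and $\sigma\in[M]$ there is at least one edge $(s,q,\sigma)\in E$; deterministic if for every $s\in S$ and $\sigma\in[M]$ there is at most one such edge; strongly connected if for all $p,q\in S$ there is a path from $p$ to $q$. A sub-graph consists of a nonempty subset of nodes and a subset of the edges between these nodes. Path-Complete Lyapunov function: a path-complete graph $\mathbf{G}=(S,E)$ together with functions (pieces) $V_s:\mathbb{R}^n\to\mathbb{R}^+$,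 $s\in S$, such that there are $\mathcal{K}_\infty$-functions $\alpha_1,\alpha_2$ (continuous, strictly increasing, unbounded functions $\mathbb{R}^+\to\mathbb{R}^+$ vanishing at $0$) with $\alpha_1(\|x\|)\le V_s(x)\le\alpha_2(\|x\|)$ for all $x\in\mathbb{R}^n$, $s\in S$, and such that for every $(p,q,\sigma)\in E$ and all $x\in\mathbb{R}^n$, $V_q(f_\sigma(x))\le V_p(x)$. Common Lyapunov function: a function $V:\mathbb{R}^n\to\mathbb{R}^+$ with $V(f_\sigma(x))\le V(x)$ for all $x\in\mathbb{R}^n$ and $\sigma\in[M]$, and with $\alpha_1(\|x\|)\le V(x)\le\alpha_2(\|x\|)$ for all $x$, for some $\mathcal{K}_\infty$-functions $\alpha_1,\alpha_2$. Observer graph $O(\mathbf{G})=(S_O,E_O)$: its nodes are subsets of $S$. It is the smallest graph such that $S\in S_O$ and, whenever $P\in S_O$, $\sigma\in[M]$ and $Q:=\bigcup_{p\in P}\{q\in S:(p,q,\sigma)\in E\}\neq\emptyset$, one has $Q\in S_O$ and $(P,Q,\sigma)\in E_O$. For $\mathbf{G}$ path-complete, $O(\mathbf{G})$ contains exactly one sub-graph that is strongly connected, deterministic and complete; it is denoted $O^\star(\mathbf{G})=(S_O^\star,E_O^\star)$. *)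

theory Defs
  imports "HOL-Analysis.Analysis" "HOL-Library.Sublist"
begin

text \<open>The label alphabet is \<open>{1..M}\<close>; an edge \<open>(p, q, \<sigma>)\<close> goes from \<open>p\<close> to \<open>q\<close>
  with label \<open>\<sigma>\<close>.\<close>

record 's lgraph =
  nodes :: "'s set"
  edges :: "('s \<times> 's \<times> nat) set"

definition labeled_graph :: "nat \<Rightarrow> 's lgraph \<Rightarrow> bool" where
  "labeled_graph M G \<longleftrightarrow>
     finite (nodes G) \<and> nodes G \<noteq> {} \<and> edges G \<subseteq> nodes G \<times> nodes G \<times> {1..M}"

fun is_lpath :: "'s lgraph \<Rightarrow> 's \<Rightarrow> ('s \<times> 's \<times> nat) list \<Rightarrow> 's \<Rightarrow> bool" where
  "is_lpath G p [] q \<longleftrightarrow> p \<in> nodes G \<and> p = q"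
| "is_lpath G p (e # es) q \<longleftrightarrow> e \<in> edges G \<and> fst e = p \<and> is_lpath G (fst (snd e)) es q"

definition path_label :: "('s \<times> 's \<times> nat) list \<Rightarrow> nat list" where
  "path_label es = map (\<lambda>e. snd (snd e)) es"

text \<open>The library predicate \<open>sublist\<close> is the contiguous one.\<close>

definition path_complete_graph :: "nat \<Rightarrow> 's lgraph \<Rightarrow> bool" where
  "path_complete_graph M G \<longleftrightarrow>
     (\<forall>w. set w \<subseteq> {1..M} \<longrightarrow> (\<exists>p es q. is_lpath G p es q \<and> sublist w (path_label es)))"

definition complete_graph :: "nat \<Rightarrow> 's lgraph \<Rightarrow> bool" where
  "complete_graph M G \<longleftrightarrow> (\<forall>s\<in>nodes G. \<forall>\<sigma>\<in>{1..M}. \<exists>q. (s, q, \<sigma>) \<in> edges G)"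

definition deterministic_graph :: "nat \<Rightarrow> 's lgraph \<Rightarrow> bool" where
  "deterministic_graph M G \<longleftrightarrow>
     (\<forall>s\<in>nodes G. \<forall>\<sigma>\<in>{1..M}. \<exists>\<^sub>\<le>\<^sub>1 q. (s, q, \<sigma>) \<in> edges G)"

definition strongly_connected_graph :: "'s lgraph \<Rightarrow> bool" where
  "strongly_connected_graph G \<longleftrightarrow> (\<forall>p\<in>nodes G. \<forall>q\<in>nodes G. \<exists>es. is_lpath G p es q)"

definition is_subgraph :: "'s lgraph \<Rightarrow> 's lgraph \<Rightarrow> bool" where
  "is_subgraph H G \<longleftrightarrow>
     nodes H \<noteq> {} \<and> nodes H \<subseteq> nodes G \<and>
     edges H \<subseteq> edges G \<and> edges H \<subseteq> nodes H \<times> nodes H \<times> UNIV"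

definition obs_succ :: "'s lgraph \<Rightarrow> 's set \<Rightarrow> nat \<Rightarrow> 's set" where
  "obs_succ G P \<sigma> = (\<Union>p\<in>P. {q \<in> nodes G. (p, q, \<sigma>) \<in> edges G})"

inductive_set obs_nodes :: "nat \<Rightarrow> 's lgraph \<Rightarrow> 's set set" for M G where
  init: "nodes G \<in> obs_nodes M G"
| step: "P \<in> obs_nodes M G \<Longrightarrow> \<sigma> \<in> {1..M} \<Longrightarrow> obs_succ G P \<sigma> \<noteq> {}
         \<Longrightarrow> obs_succ G P \<sigma> \<in> obs_nodes M G"

definition observer :: "nat \<Rightarrow> 's lgraph \<Rightarrow> 's set lgraph" where
  "observer M G =
     \<lparr> nodes = obs_nodes M G,
       edges = {(P, obs_succ G P \<sigma>, \<sigma>) | P \<sigma>.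
                  P \<in> obs_nodes M G \<and> \<sigma> \<in> {1..M} \<and> obs_succ G P \<sigma> \<noteq> {}} \<rparr>"

definition is_observer_star :: "nat \<Rightarrow> 's lgraph \<Rightarrow> 's set lgraph \<Rightarrow> bool" where
  "is_observer_star M G H \<longleftrightarrow>
     is_subgraph H (observer M G) \<and> strongly_connected_graph H \<and>
     deterministic_graph M H \<and> complete_graph M H"

text \<open>This description is proper for path-complete \<open>G\<close>: see \<open>ex1_observer_star\<close> below.\<close>

definition observer_star :: "nat \<Rightarrow> 's lgraph \<Rightarrow> 's set lgraph" where
  "observer_star M G = (THE H. is_observer_star M G H)"

definition switching_system :: "nat \<Rightarrow> (nat \<Rightarrow> real ^ 'n \<Rightarrow> real ^ 'n) \<Rightarrow> bool" where
  "switching_system M f \<longleftrightarrow>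
     M \<ge> 1 \<and> (\<forall>i\<in>{1..M}. continuous_on UNIV (f i) \<and> (\<forall>x. f i x = 0 \<longleftrightarrow> x = 0))"

text \<open>Only the values on \<open>{0..}\<close> matter.\<close>

definition class_K_infinity :: "(real \<Rightarrow> real) \<Rightarrow> bool" where
  "class_K_infinity \<alpha> \<longleftrightarrow>
     \<alpha> ` {0..} \<subseteq> {0..} \<and> \<alpha> 0 = 0 \<and> continuous_on {0..} \<alpha> \<and>
     strict_mono_on {0..} \<alpha> \<and> \<not> bdd_above (\<alpha> ` {0..})"

definition path_complete_lyapunov ::
  "nat \<Rightarrow> (nat \<Rightarrow> real ^ 'n \<Rightarrow> real ^ 'n) \<Rightarrow> 's lgraph \<Rightarrow> ('s \<Rightarrow> real ^ 'n \<Rightarrow> real) \<Rightarrow> bool" where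
  "path_complete_lyapunov M f G V \<longleftrightarrow>
     labeled_graph M G \<and> path_complete_graph M G \<and>
     (\<forall>s\<in>nodes G. \<forall>x. V s x \<ge> 0) \<and>
     (\<exists>\<alpha>1 \<alpha>2. class_K_infinity \<alpha>1 \<and> class_K_infinity \<alpha>2 \<and>
        (\<forall>x. \<forall>s\<in>nodes G. \<alpha>1 (norm x) \<le> V s x \<and> V s x \<le> \<alpha>2 (norm x))) \<and>
     (\<forall>(p, q, \<sigma>)\<in>edges G. \<forall>x. V q (f \<sigma> x) \<le> V p x)"

definition common_lyapunov ::
  "nat \<Rightarrow> (nat \<Rightarrow> real ^ 'n \<Rightarrow> real ^ 'n) \<Rightarrow> (real ^ 'n \<Rightarrow> real) \<Rightarrow> bool" where
  "common_lyapunov M f V \<longleftrightarrow>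
     (\<forall>x. V x \<ge> 0) \<and>
     (\<forall>x. \<forall>\<sigma>\<in>{1..M}. V (f \<sigma> x) \<le> V x) \<and>
     (\<exists>\<alpha>1 \<alpha>2. class_K_infinity \<alpha>1 \<and> class_K_infinity \<alpha>2 \<and>
        (\<forall>x. \<alpha>1 (norm x) \<le> V x \<and> V x \<le> \<alpha>2 (norm x)))"

definition obs_run :: "'s lgraph \<Rightarrow> 's set \<Rightarrow> nat list \<Rightarrow> 's set" where
  "obs_run G P w = foldl (obs_succ G) P w"

lemma obs_run_simps [simp]:
  "obs_run G P [] = P"
  "obs_run G P (a # w) = obs_run G (obs_succ G P a) w"
  "obs_run G P (u @ w) = obs_run G (obs_run G P u) w"
  by (simp_all add: obs_run_def)

lemma obs_succ_mono: "P \<subseteq> Q \<Longrightarrow> obs_succ G P a \<subseteq> obs_succ G Q a"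
  by (auto simp: obs_succ_def)

lemma obs_run_mono: "P \<subseteq> Q \<Longrightarrow> obs_run G P w \<subseteq> obs_run G Q w"
  by (induction w arbitrary: P Q) (simp_all add: obs_succ_mono)

lemma obs_run_empty: "obs_run G {} w = {}"
  by (induction w) (simp_all add: obs_succ_def)

lemma obs_run_nodes: "P \<subseteq> nodes G \<Longrightarrow> obs_run G P w \<subseteq> nodes G"
proof (induction w arbitrary: P)
  case (Cons a w)
  have "obs_succ G P a \<subseteq> nodes G" by (auto simp: obs_succ_def)
  then show ?case using Cons.IH by simp
qed simp

lemma is_lpath_start: "is_lpath G p es q \<Longrightarrow> edges G \<subseteq> nodes G \<times> nodes G \<times> X \<Longrightarrow> p \<in> nodes G"
  by (cases es) auto

lemma is_lpath_obs_run:
  assumes "edges G \<subseteq> nodes G \<times> nodes G \<times> X"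
  shows "is_lpath G p es q \<Longrightarrow> p \<in> P \<Longrightarrow> q \<in> obs_run G P (path_label es)"
proof (induction es arbitrary: p P)
  case (Cons e es)
  obtain r \<sigma> where e: "e = (p, r, \<sigma>)" using Cons.prems(1) by (cases e) auto
  have "r \<in> obs_succ G P \<sigma>"
    using Cons.prems assms e by (auto simp: obs_succ_def)
  then show ?case using Cons.IH[of r] Cons.prems(1) e by (simp add: path_label_def)
qed (simp add: path_label_def)

lemma obs_run_nonempty:
  assumes "labeled_graph M G" "path_complete_graph M G" "set w \<subseteq> {1..M}"
  shows "obs_run G (nodes G) w \<noteq> {}"
proof
  assume 0: "obs_run G (nodes G) w = {}"
  have E: "edges G \<subseteq> nodes G \<times> nodes G \<times> {1..M}"
    using assms(1) by (simp add: labeled_graph_def)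
  obtain p es q where pth: "is_lpath G p es q" and "sublist w (path_label es)"
    using assms(2,3) unfolding path_complete_graph_def by blast
  then obtain u v where "path_label es = u @ w @ v" by (auto simp: sublist_def)
  then have "q \<in> obs_run G (obs_run G (obs_run G (nodes G) u) w) v"
    using is_lpath_obs_run[OF E pth is_lpath_start[OF pth E]] by simp
  moreover have "obs_run G (obs_run G (nodes G) u) w = {}"
    using obs_run_mono[OF obs_run_nodes[OF subset_refl, of G u], of G w] 0 by auto
  ultimately show False by (simp add: obs_run_empty)
qed

lemma obs_nodes_run: "P \<in> obs_nodes M G \<Longrightarrow> \<exists>w. set w \<subseteq> {1..M} \<and> P = obs_run G (nodes G) w"
proof (induction rule: obs_nodes.induct)
  case init
  show ?case by (rule exI[of _ "[]"]) simp
next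
  case (step P \<sigma>)
  then obtain w where "set w \<subseteq> {1..M}" "P = obs_run G (nodes G) w" by blast
  then show ?case using step.hyps(2) by (intro exI[of _ "w @ [\<sigma>]"]) simp
qed

lemma obs_succ_in:
  assumes "labeled_graph M G" "path_complete_graph M G" "P \<in> obs_nodes M G" "\<sigma> \<in> {1..M}"
  shows "obs_succ G P \<sigma> \<noteq> {}" "obs_succ G P \<sigma> \<in> obs_nodes M G"
proof -
  obtain w where "set w \<subseteq> {1..M}" "P = obs_run G (nodes G) w"
    using obs_nodes_run[OF assms(3)] by blast
  then show "obs_succ G P \<sigma> \<noteq> {}"
    using obs_run_nonempty[OF assms(1,2), of "w @ [\<sigma>]"] assms(4) by simp
  then show "obs_succ G P \<sigma> \<in> obs_nodes M G"
    using obs_nodes.step assms(3,4) by blast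
qed

lemma obs_run_in:
  assumes "labeled_graph M G" "path_complete_graph M G"
  shows "P \<in> obs_nodes M G \<Longrightarrow> set w \<subseteq> {1..M} \<Longrightarrow> obs_run G P w \<in> obs_nodes M G"
  by (induction w arbitrary: P) (simp_all add: obs_succ_in[OF assms])

lemma finite_obs_nodes:
  assumes "labeled_graph M G"
  shows "finite (obs_nodes M G)"
proof (rule finite_subset)
  show "obs_nodes M G \<subseteq> Pow (nodes G)"
    using obs_nodes_run obs_run_nodes[OF subset_refl] by fastforce
  show "finite (Pow (nodes G))" using assms by (simp add: labeled_graph_def)
qed

lemma observer_star_edges:
  assumes "is_observer_star M G H"
  shows "edges H = {(P, obs_succ G P \<sigma>, \<sigma>) | P \<sigma>. P \<in> nodes H \<and> \<sigma> \<in> {1..M}}"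
proof -
  have sub: "edges H \<subseteq> edges (observer M G)" "edges H \<subseteq> nodes H \<times> nodes H \<times> UNIV"
    and c: "complete_graph M H"
    using assms by (auto simp: is_observer_star_def is_subgraph_def)
  have *: "P \<in> nodes H \<and> \<sigma> \<in> {1..M} \<and> Q = obs_succ G P \<sigma>" if "(P, Q, \<sigma>) \<in> edges H" for P Q \<sigma>
    using that sub by (auto simp: observer_def)
  then have "(P, obs_succ G P \<sigma>, \<sigma>) \<in> edges H" if "P \<in> nodes H" "\<sigma> \<in> {1..M}" for P \<sigma>
    using c that unfolding complete_graph_def by metis
  with * show ?thesis by fastforce
qed

lemma observer_star_run:
  assumes "is_observer_star M G H"
  shows "P \<in> nodes H \<Longrightarrow> set w \<subseteq> {1..M} \<Longrightarrow> obs_run G P w \<in> nodes H"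
proof (induction w arbitrary: P)
  case (Cons a w)
  have "(P, obs_succ G P a, a) \<in> edges H"
    using Cons.prems by (auto simp: observer_star_edges[OF assms])
  then have "obs_succ G P a \<in> nodes H"
    using assms by (auto simp: is_observer_star_def is_subgraph_def)
  then show ?case using Cons by simp
qed simp

lemma observer_star_lpath:
  assumes "is_observer_star M G H"
  shows "is_lpath H P es Q \<Longrightarrow> \<exists>w. set w \<subseteq> {1..M} \<and> Q = obs_run G P w"
proof (induction es arbitrary: P)
  case Nil
  then show ?case by (intro exI[of _ "[]"]) simp
next
  case (Cons e es)
  from Cons.prems obtain \<sigma> where e: "e = (P, obs_succ G P \<sigma>, \<sigma>)" "\<sigma> \<in> {1..M}"
    by (auto simp: observer_star_edges[OF assms])
  with Cons obtain w where "set w \<subseteq> {1..M}" "Q = obs_run G (obs_succ G P \<sigma>) w" by auto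
  with e show ?case by (intro exI[of _ "\<sigma> # w"]) simp
qed

lemma observer_star_nodes:
  assumes "is_observer_star M G H" "P \<in> nodes H"
  shows "nodes H = {obs_run G P w | w. set w \<subseteq> {1..M}}"
proof -
  have "\<exists>es. is_lpath H P es Q" if "Q \<in> nodes H" for Q
    using assms that by (auto simp: is_observer_star_def strongly_connected_graph_def)
  then show ?thesis
    using observer_star_run[OF assms] observer_star_lpath[OF assms(1)] by blast
qed

lemma observer_star_min:
  assumes "is_observer_star M G H1" "is_observer_star M G H2"
    and "P \<in> nodes H1" and min: "\<forall>Q\<in>nodes H2. Q \<subseteq> P \<longrightarrow> Q = P"
  shows "P \<in> nodes H2"
proof -
  have sub: "nodes H1 \<subseteq> obs_nodes M G" "nodes H2 \<subseteq> obs_nodes M G" "nodes H2 \<noteq> {}"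
    using assms(1,2) by (auto simp: is_observer_star_def is_subgraph_def observer_def)
  then obtain Q where Q: "Q \<in> nodes H2" "Q \<in> obs_nodes M G" by blast
  obtain w where w: "set w \<subseteq> {1..M}" "P = obs_run G (nodes G) w"
    using obs_nodes_run assms(3) sub by blast
  have "Q \<subseteq> nodes G"
    using obs_nodes_run[OF Q(2)] obs_run_nodes[OF subset_refl] by fastforce
  then have "obs_run G Q w \<subseteq> P" using obs_run_mono w(2) by blast
  moreover have "obs_run G Q w \<in> nodes H2" using observer_star_run[OF assms(2) Q(1) w(1)] .
  ultimately show ?thesis using min by auto
qed

lemma observer_star_unique:
  assumes G: "labeled_graph M G" and H: "is_observer_star M G H1" "is_observer_star M G H2"
  shows "H1 = H2"
proof -
  let ?N = "nodes H1 \<union> nodes H2"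
  have "?N \<subseteq> obs_nodes M G" "?N \<noteq> {}"
    using H by (auto simp: is_observer_star_def is_subgraph_def observer_def)
  then have "finite ?N" "?N \<noteq> {}" using finite_subset finite_obs_nodes[OF G] by auto
  then obtain P where P: "P \<in> ?N" and min: "\<forall>Q\<in>?N. Q \<subseteq> P \<longrightarrow> Q = P"
    using finite_has_minimal[of ?N] by auto
  have "P \<in> nodes H1 \<and> P \<in> nodes H2"
  proof (cases "P \<in> nodes H1")
    case True
    then show ?thesis using observer_star_min[OF H True] min by blast
  next
    case False
    then have "P \<in> nodes H2" using P by blast
    then show ?thesis using observer_star_min[OF H(2,1)] min by blast
  qed
  then have "nodes H1 = nodes H2"
    using observer_star_nodes[OF H(1), of P] observer_star_nodes[OF H(2), of P] by simp
  moreover from this have "edges H1 = edges H2"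
    by (simp add: observer_star_edges[OF H(1)] observer_star_edges[OF H(2)])
  ultimately show ?thesis by simp
qed

lemma observer_star_exists:
  assumes G: "labeled_graph M G" "path_complete_graph M G"
  shows "\<exists>H. is_observer_star M G H"
proof -
  define R where "R P = {obs_run G P w | w. set w \<subseteq> {1..M}}" for P
  have Rsub: "R A \<subseteq> R P" if "A \<in> R P" for A P
  proof
    fix B assume "B \<in> R A"
    with that obtain u w where "set u \<subseteq> {1..M}" "A = obs_run G P u"
      "set w \<subseteq> {1..M}" "B = obs_run G A w" by (auto simp: R_def)
    then have "set (u @ w) \<subseteq> {1..M}" "B = obs_run G P (u @ w)" by auto
    then show "B \<in> R P" unfolding R_def by blast
  qed
  have RN: "R P \<subseteq> obs_nodes M G" if "P \<in> obs_nodes M G" for P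
    using obs_run_in[OF G that] by (auto simp: R_def)
  have "finite (R ` obs_nodes M G)" "R ` obs_nodes M G \<noteq> {}"
    using finite_obs_nodes[OF G(1)] obs_nodes.init by blast+
  then obtain P where P: "P \<in> obs_nodes M G"
    and min: "\<forall>A\<in>obs_nodes M G. R A \<subseteq> R P \<longrightarrow> R A = R P"
    using finite_has_minimal[of "R ` obs_nodes M G"] by auto
  have Req: "R A = R P" if "A \<in> R P" for A
    using min RN[OF P] Rsub[OF that] that by blast
  have succ: "obs_succ G A \<sigma> \<in> R P" if "A \<in> R P" "\<sigma> \<in> {1..M}" for A \<sigma>
  proof -
    have "obs_succ G A \<sigma> \<in> R A"
      using that(2) unfolding R_def by (auto intro!: exI[of _ "[\<sigma>]"])
    then show ?thesis using Req[OF that(1)] by simp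
  qed
  define H where "H = \<lparr> nodes = R P,
    edges = {(A, obs_succ G A \<sigma>, \<sigma>) | A \<sigma>. A \<in> R P \<and> \<sigma> \<in> {1..M}} \<rparr>"
  have path: "\<exists>es. is_lpath H A es (obs_run G A w)" if "A \<in> R P" "set w \<subseteq> {1..M}" for A w
    using that
  proof (induction w arbitrary: A)
    case Nil
    then show ?case by (intro exI[of _ "[]"]) (simp add: H_def)
  next
    case (Cons a w)
    then have "a \<in> {1..M}" by simp
    from Cons succ[OF Cons.prems(1) this]
    obtain es where "is_lpath H (obs_succ G A a) es (obs_run G A (a # w))" by auto
    then show ?case using Cons.prems
      by (intro exI[of _ "(A, obs_succ G A a, a) # es"]) (auto simp: H_def)
  qed
  have "strongly_connected_graph H"
    unfolding strongly_connected_graph_def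
  proof (intro ballI)
    fix A B assume "A \<in> nodes H" "B \<in> nodes H"
    then have A: "A \<in> R P" and "B \<in> R A" using Req by (simp_all add: H_def)
    then obtain w where "set w \<subseteq> {1..M}" "B = obs_run G A w" by (auto simp: R_def)
    then show "\<exists>es. is_lpath H A es B" using path[OF A] by blast
  qed
  moreover have "P \<in> R P" unfolding R_def by (auto intro!: exI[of _ "[]"])
  then have "is_subgraph H (observer M G)"
    using RN[OF P] succ obs_succ_in(1)[OF G]
    by (auto simp: is_subgraph_def H_def observer_def)
  moreover have "deterministic_graph M H" "complete_graph M H"
    by (auto simp: deterministic_graph_def complete_graph_def H_def Uniq_def)
  ultimately show ?thesis unfolding is_observer_star_def by blast
qed

theorem ex1_observer_star:
  assumes "labeled_graph M G" "path_complete_graph M G"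
  shows "\<exists>!H. is_observer_star M G H"
  using observer_star_exists[OF assms] observer_star_unique[OF assms(1)] by blast

end

theory Submission
  imports Defs
begin

text \<open>Let \<open>Q\<close> attain the minimum at \<open>x\<close>. By completeness, the \<open>\<sigma>\<close>-successor \<open>Q'\<close> of \<open>Q\<close> in the
  observer is again a node of the star component. Every \<open>q \<in> Q'\<close> has a \<open>\<sigma>\<close>-predecessor
  \<open>p \<in> Q\<close>, so \<open>V\<^sub>q (f\<^sub>\<sigma> x) \<le> V\<^sub>p x\<close>, and the maximum over \<open>Q'\<close> at \<open>f\<^sub>\<sigma> x\<close> is at most the maximum
  over \<open>Q\<close> at \<open>x\<close>.\<close>

lemma is_observer_star_observer_star:
  assumes "labeled_graph M G" "path_complete_graph M G"
  shows "is_observer_star M G (observer_star M G)"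
  unfolding observer_star_def using ex1_observer_star[OF assms] by (rule theI')

lemma obs_nodes_subset_nodes: "P \<in> obs_nodes M G \<Longrightarrow> P \<subseteq> nodes G"
  using obs_nodes_run obs_run_nodes[OF subset_refl] by fastforce

text \<open>A node is the run of \<open>nodes G\<close> along some word, and by path-completeness
  some path reading that word survives the run. This keeps the inner \<open>MAX\<close> off the
  empty set, where \<open>Max\<close> is unspecified.\<close>

lemma obs_nodes_nonempty:
  assumes "labeled_graph M G" "path_complete_graph M G" "P \<in> obs_nodes M G"
  shows "P \<noteq> {}"
  using obs_nodes_run[OF assms(3)] obs_run_nonempty[OF assms(1,2)] by blast

lemma observer_star_obs_succ:
  assumes "is_observer_star M G H" "P \<in> nodes H" "\<sigma> \<in> {1..M}"
  shows "obs_succ G P \<sigma> \<in> nodes H"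
  using observer_star_run[OF assms(1,2), of "[\<sigma>]"] assms(3) by simp

text \<open>\<open>W\<close> and \<open>W'\<close> stand for the pieces at \<open>x\<close> and at
  \<open>f \<sigma> x\<close>; each \<open>q\<close> in the successor is charged to a predecessor in
  \<open>P\<close>.\<close>

lemma Max_obs_succ_le:
  fixes W W' :: "'s \<Rightarrow> real"
  assumes "finite P" "finite (obs_succ G P \<sigma>)" "obs_succ G P \<sigma> \<noteq> {}"
    and le: "\<And>p q. (p, q, \<sigma>) \<in> edges G \<Longrightarrow> W' q \<le> W p"
  shows "(MAX q\<in>obs_succ G P \<sigma>. W' q) \<le> (MAX p\<in>P. W p)"
proof (rule Max.boundedI)
  fix y assume "y \<in> W' ` obs_succ G P \<sigma>"
  then obtain p q where "p \<in> P" "(p, q, \<sigma>) \<in> edges G" "y = W' q"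
    by (auto simp: obs_succ_def)
  moreover from this have "W p \<le> (MAX p\<in>P. W p)"
    using assms(1) by simp
  ultimately show "y \<le> (MAX p\<in>P. W p)" using le order_trans by blast
qed (use assms in auto)

text \<open>Finite extrema are attained: \<open>Q\<close> serves the decrease along the system,
  \<open>s\<close> the pointwise bounds.\<close>

lemma Min_Max_mem:
  fixes W :: "'s \<Rightarrow> 'a::linorder"
  assumes "finite N" "N \<noteq> {}" "\<And>Q. Q \<in> N \<Longrightarrow> finite Q \<and> Q \<noteq> {}"
  obtains Q s where "Q \<in> N" "s \<in> Q"
    "(MIN Q\<in>N. MAX s\<in>Q. W s) = (MAX s\<in>Q. W s)" "(MAX s\<in>Q. W s) = W s"
proof -
  have "(MIN Q\<in>N. MAX s\<in>Q. W s) \<in> (\<lambda>Q. MAX s\<in>Q. W s) ` N"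
    by (rule Min_in) (use assms(1,2) in auto)
  then obtain Q where Q: "Q \<in> N" "(MIN Q\<in>N. MAX s\<in>Q. W s) = (MAX s\<in>Q. W s)"
    by blast
  moreover have "(MAX s\<in>Q. W s) \<in> W ` Q"
    by (rule Max_in) (use assms(3)[OF Q(1)] in auto)
  then obtain s where "s \<in> Q" "(MAX s\<in>Q. W s) = W s"
    by blast
  ultimately show thesis using that by blast
qed

theorem theorem1:
  fixes M :: nat
    and f :: "nat \<Rightarrow> real ^ 'n \<Rightarrow> real ^ 'n"
    and G :: "'s lgraph"
    and V :: "'s \<Rightarrow> real ^ 'n \<Rightarrow> real"
  assumes "switching_system M f"
    and "path_complete_lyapunov M f G V"
  shows "common_lyapunov M f (\<lambda>x. MIN Q\<in>nodes (observer_star M G). MAX s\<in>Q. V s x)"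
proof -
  have G: "labeled_graph M G" "path_complete_graph M G"
    and V_nonneg: "\<And>s x. s \<in> nodes G \<Longrightarrow> 0 \<le> V s x"
    and V_decr: "\<And>p q \<sigma> x. (p, q, \<sigma>) \<in> edges G \<Longrightarrow> V q (f \<sigma> x) \<le> V p x"
    using assms(2) by (auto simp: path_complete_lyapunov_def)
  obtain \<alpha>1 \<alpha>2 where \<alpha>: "class_K_infinity \<alpha>1" "class_K_infinity \<alpha>2"
    and V_bounds: "\<And>s x. s \<in> nodes G \<Longrightarrow> \<alpha>1 (norm x) \<le> V s x \<and> V s x \<le> \<alpha>2 (norm x)"
    using assms(2) by (auto simp: path_complete_lyapunov_def)
  define N where "N = nodes (observer_star M G)"
  note star = is_observer_star_observer_star[OF G]
  have N: "N \<subseteq> obs_nodes M G" "N \<noteq> {}"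
    using star by (auto simp: N_def is_observer_star_def is_subgraph_def observer_def)
  have finN: "finite N" using N(1) finite_obs_nodes[OF G(1)] finite_subset by blast
  have sub: "Q \<subseteq> nodes G" if "Q \<in> N" for Q
    using that N(1) obs_nodes_subset_nodes by blast
  have Q: "finite Q \<and> Q \<noteq> {}" if "Q \<in> N" for Q
    using that N(1) sub[OF that] obs_nodes_nonempty[OF G] G(1) finite_subset
    unfolding labeled_graph_def by blast
  \<comment> \<open>At each \<open>x\<close> the min-max equals a single piece, which may vary with
    \<open>x\<close>. The bounds are uniform in \<open>s\<close>, so they carry over with the same
    \<open>\<alpha>1\<close> and \<open>\<alpha>2\<close>.\<close>
  have attained: "\<exists>s\<in>nodes G. (MIN Q\<in>N. MAX s\<in>Q. V s x) = V s x" for x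
  proof -
    obtain P s where "P \<in> N" "s \<in> P" "(MIN Q\<in>N. MAX s\<in>Q. V s x) = V s x"
      using Min_Max_mem[OF finN N(2) Q, of "\<lambda>s. V s x"] by metis
    then show ?thesis using sub by blast
  qed
  have decr: "(MIN Q\<in>N. MAX s\<in>Q. V s (f \<sigma> x)) \<le> (MIN Q\<in>N. MAX s\<in>Q. V s x)"
    if \<sigma>: "\<sigma> \<in> {1..M}" for \<sigma> x
  proof -
    obtain P where P: "P \<in> N" "(MIN Q\<in>N. MAX s\<in>Q. V s x) = (MAX s\<in>P. V s x)"
      using Min_Max_mem[OF finN N(2) Q, of "\<lambda>s. V s x"] by metis
    \<comment> \<open>The successor need not be the minimizer at \<open>f \<sigma> x\<close>; as a
      member of \<open>N\<close> it bounds the minimum there from above.\<close>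
    have P': "obs_succ G P \<sigma> \<in> N"
      using observer_star_obs_succ[OF star] P(1) \<sigma> by (simp add: N_def)
    then have "(MIN Q\<in>N. MAX s\<in>Q. V s (f \<sigma> x)) \<le> (MAX s\<in>obs_succ G P \<sigma>. V s (f \<sigma> x))"
      using finN by simp
    also have "\<dots> \<le> (MAX s\<in>P. V s x)"
      using Q[OF P(1)] Q[OF P'] V_decr by (intro Max_obs_succ_le) auto
    finally show ?thesis using P(2) by simp
  qed
  have "0 \<le> (MIN Q\<in>N. MAX s\<in>Q. V s x)" for x
    using attained[of x] V_nonneg by auto
  moreover have "\<alpha>1 (norm x) \<le> (MIN Q\<in>N. MAX s\<in>Q. V s x) \<and>
      (MIN Q\<in>N. MAX s\<in>Q. V s x) \<le> \<alpha>2 (norm x)" for x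
    using attained[of x] V_bounds by auto
  ultimately show ?thesis
    unfolding common_lyapunov_def N_def[symmetric] using decr \<alpha> by blast
qed

end
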